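(* The following properties hold: (i) $\mathbb{WGAO}\subsetneq\mathbb{DGAO}$; (ii) $\mathbb{WGAO}\cap\mathbb{FSDGAO}\neq\emptyset$; (iii) $\mathbb{WGAO}\cap\mathbb{FSDGAO}\subsetneq\mathbb{FSDGAO}$; (iv) $\mathbb{WGAO}\setminus\mathbb{FSGAO}\neq\emptyset$; (v) $\mathbb{BAO}\subsetneq(\mathbb{WGAO}\cap\mathbb{FSGAO})$.
   Context: A G\"odel algebra is a Heyting algebra $\mathbf{A}=(A,\wedge,\vee,\to,\bot,\top)$ satisfying prelinearity $(a\to b)\vee(b\to a)=\top$; $\neg x=x\to\bot$. A GAO (G\"odel algebra with operators) is a triple $(\mathbf{A},\Box,\Diamond)$ with $\mathbf{A}$ a G\"odel algebra and $\Box,\Diamond:A\to A$ satisfying $\Box\top=\top$, $\Box(x\wedge y)=\Box x\wedge\Box y$, $\Diamond\bot=\bot$, $\Diamond(x\vee y)=\Diamond x\vee\Diamond y$. The following are classes (varieties) of GAOs: $\mathbb{DGAO}$: GAOs satisfying, for all $a,b$, $\Box(a\vee b)\leq\Box a\vee\Diamond b$ and $\Box a\wedge\Diamond b\leq\Diamond(a\wedge b)$. $\mathbb{FSGAO}$: GAOs satisfying, for all $a,b$, $\Diamond(a\to b)\leq(\Box a\to\Diamond b)$ and $(\Diamond a\to\Box b)\leq\Box(a\to b)$. $\mathbb{FSDGAO}=\mathbb{DGAO}\cap\mathbb{FSGAO}$. $\mathbb{WGAO}$: algebras in $\mathbb{DGAO}$ satisfying, for all $x$, $\Box x\vee\neg\Box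 x=\top$ and $\Diamond x\vee\neg\Diamond x=\top$. $\mathbb{BAO}$: Boolean algebras with operators, i.e. GAOs whose underlying G\"odel algebra is a Boolean algebra and in which $\Diamond a=\neg\Box\neg a$ for all $a$. *)

theory Defs
  imports "HOL-Algebra.Lattice"
begin

text \<open>
  Algebras are carrier-based records extending the orders of HOL-Algebra, so that a class of
  algebras is a set of records.  Meet, join, top and bottom are those of the lattice order and are
  therefore not separate fields.
\<close>

record 'a heyting = "'a gorder" +
  imp :: "'a \<Rightarrow> 'a \<Rightarrow> 'a" (infixr \<open>\<^bold>\<rightarrow>\<index>\<close> 60)

definition neg :: "('a, 'b) heyting_scheme \<Rightarrow> 'a \<Rightarrow> 'a" (\<open>\<^bold>\<not>\<index> _\<close> [81] 80)
  where "\<^bold>\<not>\<^bsub>A\<^esub> x = x \<^bold>\<rightarrow>\<^bsub>A\<^esub> \<bottom>\<^bsub>A\<^esub>"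

locale heyting_algebra = bounded_lattice A for A (structure) +
  assumes imp_closed: "\<lbrakk>x \<in> carrier A; y \<in> carrier A\<rbrakk> \<Longrightarrow> x \<^bold>\<rightarrow> y \<in> carrier A"
    and residuation: "\<lbrakk>x \<in> carrier A; y \<in> carrier A; z \<in> carrier A\<rbrakk> \<Longrightarrow>
      z \<sqinter> x \<sqsubseteq> y \<longleftrightarrow> z \<sqsubseteq> x \<^bold>\<rightarrow> y"

locale godel_algebra = heyting_algebra +
  assumes prelinear: "\<lbrakk>x \<in> carrier A; y \<in> carrier A\<rbrakk> \<Longrightarrow> (x \<^bold>\<rightarrow> y) \<squnion> (y \<^bold>\<rightarrow> x) = \<top>"

locale boolean_lattice = bounded_lattice +
  assumes distrib: "\<lbrakk>x \<in> carrier L; y \<in> carrier L; z \<in> carrier L\<rbrakk> \<Longrightarrow>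
      x \<sqinter> (y \<squnion> z) = (x \<sqinter> y) \<squnion> (x \<sqinter> z)"
    and complemented: "x \<in> carrier L \<Longrightarrow> \<exists>y\<in>carrier L. x \<sqinter> y = \<bottom> \<and> x \<squnion> y = \<top>"

record 'a gao = "'a heyting" +
  box :: "'a \<Rightarrow> 'a" (\<open>\<box>\<index> _\<close> [81] 80)
  dia :: "'a \<Rightarrow> 'a" (\<open>\<diamond>\<index> _\<close> [81] 80)

locale gao = godel_algebra A for A (structure) +
  assumes box_closed: "x \<in> carrier A \<Longrightarrow> \<box> x \<in> carrier A"
    and dia_closed: "x \<in> carrier A \<Longrightarrow> \<diamond> x \<in> carrier A"
    and box_top: "\<box> \<top> = \<top>"
    and box_meet: "\<lbrakk>x \<in> carrier A; y \<in> carrier A\<rbrakk> \<Longrightarrow> \<box> (x \<sqinter> y) = \<box> x \<sqinter> \<box> y"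
    and dia_bottom: "\<diamond> \<bottom> = \<bottom>"
    and dia_join: "\<lbrakk>x \<in> carrier A; y \<in> carrier A\<rbrakk> \<Longrightarrow> \<diamond> (x \<squnion> y) = \<diamond> x \<squnion> \<diamond> y"

definition DGAO :: "'a gao set" where
  "DGAO = {A. gao A \<and> (\<forall>a\<in>carrier A. \<forall>b\<in>carrier A.
      \<box>\<^bsub>A\<^esub> (a \<squnion>\<^bsub>A\<^esub> b) \<sqsubseteq>\<^bsub>A\<^esub> \<box>\<^bsub>A\<^esub> a \<squnion>\<^bsub>A\<^esub> \<diamond>\<^bsub>A\<^esub> b \<and>
      \<box>\<^bsub>A\<^esub> a \<sqinter>\<^bsub>A\<^esub> \<diamond>\<^bsub>A\<^esub> b \<sqsubseteq>\<^bsub>A\<^esub> \<diamond>\<^bsub>A\<^esub> (a \<sqinter>\<^bsub>A\<^esub> b))}"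

definition FSGAO :: "'a gao set" where
  "FSGAO = {A. gao A \<and> (\<forall>a\<in>carrier A. \<forall>b\<in>carrier A.
      \<diamond>\<^bsub>A\<^esub> (a \<^bold>\<rightarrow>\<^bsub>A\<^esub> b) \<sqsubseteq>\<^bsub>A\<^esub> (\<box>\<^bsub>A\<^esub> a \<^bold>\<rightarrow>\<^bsub>A\<^esub> \<diamond>\<^bsub>A\<^esub> b) \<and>
      (\<diamond>\<^bsub>A\<^esub> a \<^bold>\<rightarrow>\<^bsub>A\<^esub> \<box>\<^bsub>A\<^esub> b) \<sqsubseteq>\<^bsub>A\<^esub> \<box>\<^bsub>A\<^esub> (a \<^bold>\<rightarrow>\<^bsub>A\<^esub> b))}"

definition FSDGAO :: "'a gao set" where
  "FSDGAO = DGAO \<inter> FSGAO"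

definition WGAO :: "'a gao set" where
  "WGAO = {A \<in> DGAO. \<forall>x\<in>carrier A.
      \<box>\<^bsub>A\<^esub> x \<squnion>\<^bsub>A\<^esub> (\<^bold>\<not>\<^bsub>A\<^esub> (\<box>\<^bsub>A\<^esub> x)) = \<top>\<^bsub>A\<^esub> \<and>
      \<diamond>\<^bsub>A\<^esub> x \<squnion>\<^bsub>A\<^esub> (\<^bold>\<not>\<^bsub>A\<^esub> (\<diamond>\<^bsub>A\<^esub> x)) = \<top>\<^bsub>A\<^esub>}"

definition BAO :: "'a gao set" where
  "BAO = {A. gao A \<and> boolean_lattice A \<and>
      (\<forall>a\<in>carrier A. \<diamond>\<^bsub>A\<^esub> a = \<^bold>\<not>\<^bsub>A\<^esub> (\<box>\<^bsub>A\<^esub> (\<^bold>\<not>\<^bsub>A\<^esub> a)))}"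

end

theory Submission
  imports Defs
begin

text \<open>
  All four separations are witnessed on the three-element chain \<open>z < m < t\<close>.  The pair
  \<open>\<box> = \<diamond> = id\<close> gives an algebra in FSDGAO in which \<open>m\<close> violates the excluded middle for
  \<open>\<box> m\<close>; the constant pair \<open>\<box> = t\<close>, \<open>\<diamond> = z\<close> lies in both WGAO and FSDGAO although the chain is
  not Boolean; and \<open>\<box> = \<diamond> =\<close> the indicator of \<open>t\<close> is crisp but violates
  \<open>\<diamond>a \<rightarrow> \<box>b \<le> \<box>(a \<rightarrow> b)\<close> at \<open>a = m\<close>, \<open>b = z\<close>.
  For the inclusion of BAO, the FS inequalities follow from the D inequalities by the excluded middle.
\<close>

section \<open>Boolean algebras with operators\<close>

context heyting_algebra
begin

lemma neg_closed [simp]: "x \<in> carrier A \<Longrightarrow> \<^bold>\<not> x \<in> carrier A"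
  by (simp add: neg_def imp_closed)

lemma le_neg_iff:
  assumes "x \<in> carrier A" "y \<in> carrier A"
  shows "x \<sqsubseteq> \<^bold>\<not> y \<longleftrightarrow> x \<sqinter> y = \<bottom>"
proof -
  have "x \<sqsubseteq> \<^bold>\<not> y \<longleftrightarrow> x \<sqinter> y \<sqsubseteq> \<bottom>"
    using residuation[of y \<bottom> x] assms by (simp add: neg_def)
  then show ?thesis
    using assms by (metis bottom_closed bottom_lower le_antisym le_refl meet_closed)
qed

lemma meet_neg:
  assumes "x \<in> carrier A"
  shows "x \<sqinter> \<^bold>\<not> x = \<bottom>"
  using le_neg_iff[of "\<^bold>\<not> x" x] assms by (simp add: meet_comm)

lemma modus_ponens:
  assumes "x \<in> carrier A" "y \<in> carrier A"
  shows "x \<sqinter> (x \<^bold>\<rightarrow> y) \<sqsubseteq> y"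
  using residuation[of x y "x \<^bold>\<rightarrow> y"] assms by (simp add: meet_comm imp_closed)

lemma le_imp:
  assumes "x \<in> carrier A" "y \<in> carrier A"
  shows "y \<sqsubseteq> x \<^bold>\<rightarrow> y"
  using residuation[of x y y] assms by (simp add: meet_left)

lemma neg_le_imp:
  assumes "x \<in> carrier A" "y \<in> carrier A"
  shows "\<^bold>\<not> x \<sqsubseteq> x \<^bold>\<rightarrow> y"
  using residuation[of x y "\<^bold>\<not> x"] assms by (simp add: meet_comm meet_neg)

end

text \<open>\<open>boolean_lattice\<close> asserts that some complement exists, while
  \<open>neg\<close> comes from residuation. Both are put on one order so that \<open>neg\<close>
  can be shown to be that complement.\<close>

locale heyting_boolean = heyting_algebra + boolean_lattice A
begin

text \<open>Residuation makes \<open>neg x\<close> the largest element disjoint from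
  \<open>x\<close>, so it lies above any complement \<open>y\<close>, and
  \<open>x \<squnion> y\<close> is already top.\<close>

lemma excluded_middle:
  assumes x: "x \<in> carrier A"
  shows "x \<squnion> \<^bold>\<not> x = \<top>"
proof -
  obtain y where y: "y \<in> carrier A" "x \<sqinter> y = \<bottom>" "x \<squnion> y = \<top>"
    using complemented x by blast
  then have "y \<sqsubseteq> \<^bold>\<not> x"
    using le_neg_iff x by (simp add: meet_comm)
  then have "x \<squnion> y \<sqsubseteq> x \<squnion> \<^bold>\<not> x"
    using x y(1) by (meson join_closed join_le join_left join_right le_trans neg_closed)
  then show ?thesis
    using x y(3) by (metis join_closed le_antisym neg_closed top_closed top_higher)
qed

text \<open>By distributivity \<open>x\<close> splits into a part inside \<open>z\<close> and a part
  inside \<open>neg z\<close>. This shunting rule is what later moves a box to the other side as a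
  diamond.\<close>

lemma le_join_negI:
  assumes "x \<in> carrier A" "y \<in> carrier A" "z \<in> carrier A"
    and "x \<sqinter> z \<sqsubseteq> y"
  shows "x \<sqsubseteq> y \<squnion> \<^bold>\<not> z"
proof -
  have "x = x \<sqinter> (z \<squnion> \<^bold>\<not> z)"
    using assms by (metis excluded_middle le_iff_join top_closed top_higher)
  also have "\<dots> = (x \<sqinter> z) \<squnion> (x \<sqinter> \<^bold>\<not> z)"
    using assms by (simp add: distrib)
  also have "\<dots> \<sqsubseteq> y \<squnion> \<^bold>\<not> z"
  proof (rule join_le)
    show "x \<sqinter> z \<sqsubseteq> y \<squnion> \<^bold>\<not> z"
      using assms by (intro le_trans[OF _ join_left]) simp_all
    show "x \<sqinter> \<^bold>\<not> z \<sqsubseteq> y \<squnion> \<^bold>\<not> z"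
      using assms by (intro le_trans[OF meet_right join_right]) simp_all
  qed (use assms in simp_all)
  finally show ?thesis .
qed

lemma imp_le_join_neg:
  assumes "x \<in> carrier A" "y \<in> carrier A"
  shows "x \<^bold>\<rightarrow> y \<sqsubseteq> y \<squnion> \<^bold>\<not> x"
  using assms modus_ponens by (intro le_join_negI) (simp_all add: imp_closed meet_comm)

lemma neg_neg:
  assumes x: "x \<in> carrier A"
  shows "\<^bold>\<not> (\<^bold>\<not> x) = x"
proof (rule le_antisym)
  have "\<^bold>\<not> (\<^bold>\<not> x) \<sqinter> \<^bold>\<not> x \<sqsubseteq> \<bottom>"
    using x by (metis bottom_closed le_refl meet_comm meet_neg neg_closed)
  \<comment> \<open>Distributing leaves a piece below \<open>x\<close> and a piece equal to bottom;
    the second factor on the left is top.\<close>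
  then have "\<^bold>\<not> (\<^bold>\<not> x) \<sqinter> (x \<squnion> \<^bold>\<not> x) \<sqsubseteq> x"
    using x by (metis bottom_closed bottom_lower distrib join_le le_antisym meet_closed meet_right neg_closed)
  then show "\<^bold>\<not> (\<^bold>\<not> x) \<sqsubseteq> x"
    using x by (metis excluded_middle le_iff_join neg_closed top_closed top_higher)
  show "x \<sqsubseteq> \<^bold>\<not> (\<^bold>\<not> x)"
    using x by (simp add: le_neg_iff meet_neg)
qed (use x in simp_all)

end

context gao
begin

lemmas operator_closed [simp] = box_closed dia_closed imp_closed

lemma box_mono:
  assumes "x \<in> carrier A" "y \<in> carrier A" "x \<sqsubseteq> y"
  shows "\<box> x \<sqsubseteq> \<box> y"
  using assms by (metis box_closed box_meet le_iff_join)

lemma dia_mono: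
  assumes "x \<in> carrier A" "y \<in> carrier A" "x \<sqsubseteq> y"
  shows "\<diamond> x \<sqsubseteq> \<diamond> y"
  using assms by (metis dia_closed dia_join le_iff_meet)

end

section \<open>The D and FS inequalities in a Boolean algebra with operators\<close>

locale bao = gao + heyting_boolean A +
  assumes dia_eq: "a \<in> carrier A \<Longrightarrow> \<diamond> a = \<^bold>\<not> (\<box> (\<^bold>\<not> a))"
begin

lemma neg_dia: "a \<in> carrier A \<Longrightarrow> \<^bold>\<not> (\<diamond> a) = \<box> (\<^bold>\<not> a)"
  by (simp add: dia_eq neg_neg)

text \<open>Apply the box to \<open>(a \<squnion> b) \<sqinter> neg b \<sqsubseteq> a\<close>, then
  shunt the factor \<open>\<box> (neg b)\<close>, whose negation is
  \<open>\<diamond> b\<close>.\<close>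

lemma box_join_le:
  assumes a: "a \<in> carrier A" and b: "b \<in> carrier A"
  shows "\<box> (a \<squnion> b) \<sqsubseteq> \<box> a \<squnion> \<diamond> b"
proof -
  have "(a \<squnion> b) \<sqinter> \<^bold>\<not> b = \<^bold>\<not> b \<sqinter> a \<squnion> \<^bold>\<not> b \<sqinter> b"
    using a b distrib[of "\<^bold>\<not> b" a b] by (metis meet_comm neg_closed)
  moreover have "\<^bold>\<not> b \<sqinter> b = \<bottom>"
    using b meet_neg by (simp add: meet_comm)
  ultimately have "(a \<squnion> b) \<sqinter> \<^bold>\<not> b \<sqsubseteq> a"
    using a b by (simp add: join_le meet_right)
  then have "\<box> (a \<squnion> b) \<sqinter> \<box> (\<^bold>\<not> b) \<sqsubseteq> \<box> a"
    using a b by (metis box_meet box_mono join_closed meet_closed neg_closed)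
  then show ?thesis
    using a b by (simp add: dia_eq le_join_negI)
qed

text \<open>Since \<open>\<diamond> (a \<sqinter> b)\<close> is the negation of
  \<open>\<box> ?c\<close>, it suffices that the left side is disjoint from
  \<open>\<box> ?c\<close>. From \<open>a \<sqinter> ?c \<sqsubseteq> neg b\<close> the common part
  \<open>?p\<close> lies below both \<open>\<box> (neg b)\<close> and its negation
  \<open>\<diamond> b\<close>.\<close>

lemma box_meet_dia_le:
  assumes a: "a \<in> carrier A" and b: "b \<in> carrier A"
  shows "\<box> a \<sqinter> \<diamond> b \<sqsubseteq> \<diamond> (a \<sqinter> b)"
proof -
  let ?c = "\<^bold>\<not> (a \<sqinter> b)"
  have c: "?c \<in> carrier A"
    using a b by simp
  have "(a \<sqinter> ?c) \<sqinter> b = \<bottom>"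
  proof -
    have "(a \<sqinter> ?c) \<sqinter> b \<sqsubseteq> a \<sqinter> b" "(a \<sqinter> ?c) \<sqinter> b \<sqsubseteq> ?c"
      using a b c by (meson meet_closed meet_le meet_left meet_right le_trans)+
    then have "(a \<sqinter> ?c) \<sqinter> b \<sqsubseteq> (a \<sqinter> b) \<sqinter> ?c"
      using a b c by (simp add: meet_le)
    then show ?thesis
      using a b c by (metis bottom_lower le_antisym meet_closed meet_neg)
  qed
  then have "\<box> (a \<sqinter> ?c) \<sqsubseteq> \<box> (\<^bold>\<not> b)"
    using a b c by (simp add: box_mono le_neg_iff)
  then have le: "\<box> a \<sqinter> \<box> ?c \<sqsubseteq> \<box> (\<^bold>\<not> b)"
    using a c by (simp add: box_meet)
  let ?p = "(\<box> a \<sqinter> \<diamond> b) \<sqinter> \<box> ?c"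
  have p: "?p \<in> carrier A"
    using a b c by simp
  have "?p \<sqsubseteq> \<box> a \<sqinter> \<box> ?c" "?p \<sqsubseteq> \<diamond> b"
    using a b c by (meson box_closed dia_closed meet_closed meet_le meet_left meet_right le_trans)+
  then have "?p \<sqsubseteq> \<box> (\<^bold>\<not> b) \<sqinter> \<^bold>\<not> (\<box> (\<^bold>\<not> b))"
    using a b c p le by (metis box_closed dia_eq le_trans meet_closed meet_le neg_closed)
  then have "?p = \<bottom>"
    using b p by (metis bottom_closed bottom_lower box_closed le_antisym meet_neg neg_closed)
  then show ?thesis
    using a b c by (simp add: dia_eq[of "a \<sqinter> b"] le_neg_iff)
qed

text \<open>The second D inequality puts \<open>a\<close> and \<open>a \<rightarrow> b\<close> under
  one diamond, where modus ponens applies; residuation then gives the claim.\<close>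

lemma dia_imp_le:
  assumes a: "a \<in> carrier A" and b: "b \<in> carrier A"
  shows "\<diamond> (a \<^bold>\<rightarrow> b) \<sqsubseteq> \<box> a \<^bold>\<rightarrow> \<diamond> b"
proof -
  have "\<box> a \<sqinter> \<diamond> (a \<^bold>\<rightarrow> b) \<sqsubseteq> \<diamond> (a \<sqinter> (a \<^bold>\<rightarrow> b))"
    using a b by (simp add: box_meet_dia_le)
  also have "\<dots> \<sqsubseteq> \<diamond> b"
    using a b by (simp add: dia_mono modus_ponens)
  finally have "\<diamond> (a \<^bold>\<rightarrow> b) \<sqinter> \<box> a \<sqsubseteq> \<diamond> b"
    using a b by (simp add: meet_comm)
  then show ?thesis
    using residuation a b by simp
qed

text \<open>In the Boolean case the left side splits into \<open>\<box> b\<close> and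
  \<open>neg (\<diamond> a) = \<box> (neg a)\<close>; both \<open>b\<close> and \<open>neg a\<close>
  lie below \<open>a \<rightarrow> b\<close>.\<close>

lemma imp_box_le:
  assumes a: "a \<in> carrier A" and b: "b \<in> carrier A"
  shows "\<diamond> a \<^bold>\<rightarrow> \<box> b \<sqsubseteq> \<box> (a \<^bold>\<rightarrow> b)"
proof -
  have "\<diamond> a \<^bold>\<rightarrow> \<box> b \<sqsubseteq> \<box> b \<squnion> \<box> (\<^bold>\<not> a)"
    using imp_le_join_neg[of "\<diamond> a" "\<box> b"] a b by (simp add: neg_dia)
  also have "\<dots> \<sqsubseteq> \<box> (a \<^bold>\<rightarrow> b)"
    using a b by (simp add: join_le box_mono le_imp neg_le_imp)
  finally show ?thesis
    using a b by simp
qed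

end

lemma BAO_imp_bao: "A \<in> BAO \<Longrightarrow> bao A"
  by (auto simp: BAO_def bao_def bao_axioms_def heyting_boolean_def
      gao_def godel_algebra_def)

lemma BAO_subset: "BAO \<subseteq> WGAO \<inter> FSGAO"
proof
  fix A :: "'a gao"
  assume "A \<in> BAO"
  then interpret bao A
    by (rule BAO_imp_bao)
  show "A \<in> WGAO \<inter> FSGAO"
    by (simp add: WGAO_def DGAO_def FSGAO_def gao_axioms box_join_le box_meet_dia_le
        dia_imp_le imp_box_le excluded_middle)
qed


section \<open>Operators on the three-element chain\<close>

text \<open>The points are parameters because the carrier must live in an arbitrary type.
  \<open>imp\<close> is the residual of a chain: top if \<open>x \<le> y\<close>, else
  \<open>y\<close>.\<close>

definition chain3 :: "'a \<Rightarrow> 'a \<Rightarrow> 'a \<Rightarrow> ('a \<Rightarrow> 'a) \<Rightarrow> ('a \<Rightarrow> 'a) \<Rightarrow> 'a gao" where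
  "chain3 z m t f g =
    \<lparr>carrier = {z, m, t}, eq = (=), le = (\<lambda>x y. x = y \<or> x = z \<or> y = t),
     imp = (\<lambda>x y. if x = y \<or> x = z \<or> y = t then t else y), box = f, dia = g\<rparr>"

locale three_chain =
  fixes z m t :: 'a and f g :: "'a \<Rightarrow> 'a"
  assumes distinct: "distinct [z, m, t]"
begin

abbreviation C where "C \<equiv> chain3 z m t f g"

lemma chain3_simps [simp]:
  "carrier C = {z, m, t}"
  "x .=\<^bsub>C\<^esub> y \<longleftrightarrow> x = y"
  "x \<sqsubseteq>\<^bsub>C\<^esub> y \<longleftrightarrow> x = y \<or> x = z \<or> y = t"
  "x \<^bold>\<rightarrow>\<^bsub>C\<^esub> y = (if x = y \<or> x = z \<or> y = t then t else y)"
  "\<box>\<^bsub>C\<^esub> x = f x"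
  "\<diamond>\<^bsub>C\<^esub> x = g x"
  by (simp_all add: chain3_def)

lemma distinct_simps [simp]: "z \<noteq> m" "m \<noteq> z" "z \<noteq> t" "t \<noteq> z" "m \<noteq> t" "t \<noteq> m"
  using distinct by auto

sublocale total_order C
  by unfold_locales (auto simp: fun_eq_iff)

sublocale bounded_lattice C
  by unfold_locales (auto simp: least_def greatest_def Upper_def Lower_def)

lemma top_simp [simp]: "\<top>\<^bsub>C\<^esub> = t"
  by (rule top_eq [symmetric]) auto

lemma bottom_simp [simp]: "\<bottom>\<^bsub>C\<^esub> = z"
  by (rule bottom_eq [symmetric]) auto

lemma join_simp [simp]:
  assumes "x \<in> {z, m, t}" "y \<in> {z, m, t}"
  shows "x \<squnion>\<^bsub>C\<^esub> y = (if x = y \<or> x = z \<or> y = t then y else x)"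
  \<comment> \<open>Despite its name, \<open>le_iff_meet\<close> expresses the order through joins,
    and \<open>le_iff_join\<close> through meets.\<close>
  using assms le_iff_meet[of x y] le_iff_meet[of y x] by (auto simp: join_comm)

lemma meet_simp [simp]:
  assumes "x \<in> {z, m, t}" "y \<in> {z, m, t}"
  shows "x \<sqinter>\<^bsub>C\<^esub> y = (if x = y \<or> x = z \<or> y = t then x else y)"
  using assms le_iff_join[of x y] le_iff_join[of y x] by (auto simp: meet_comm)

lemma carrier_cases:
  assumes "x \<in> carrier C"
  shows "x = z \<or> x = m \<or> x = t"
  using assms by simp

sublocale godel_algebra C
proof unfold_locales
  fix x y
  assume "x \<in> carrier C" "y \<in> carrier C"
  note xy = this[THEN carrier_cases]
  then show "x \<^bold>\<rightarrow>\<^bsub>C\<^esub> y \<in> carrier C"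
    by (elim disjE; simp)
  show "(x \<^bold>\<rightarrow>\<^bsub>C\<^esub> y) \<squnion>\<^bsub>C\<^esub> (y \<^bold>\<rightarrow>\<^bsub>C\<^esub> x) = \<top>\<^bsub>C\<^esub>"
    using xy by (elim disjE; simp)
  fix w
  assume "w \<in> carrier C"
  note w = this[THEN carrier_cases]
  then show "w \<sqinter>\<^bsub>C\<^esub> x \<sqsubseteq>\<^bsub>C\<^esub> y \<longleftrightarrow> w \<sqsubseteq>\<^bsub>C\<^esub> x \<^bold>\<rightarrow>\<^bsub>C\<^esub> y"
    using xy by (elim disjE; simp)
qed

text \<open>On a chain every monotone map preserves binary meets and joins. Given the normal values,
  monotonicity of \<open>f\<close> remains open only from \<open>z\<close> to \<open>m\<close>, that
  of \<open>g\<close> only from \<open>m\<close> to \<open>t\<close>.\<close>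

lemma gao_chain3:
  assumes closed: "f ` {z, m, t} \<subseteq> {z, m, t}" "g ` {z, m, t} \<subseteq> {z, m, t}"
    and normal: "f t = t" "g z = z"
    and mono: "f z \<sqsubseteq>\<^bsub>C\<^esub> f m" "g m \<sqsubseteq>\<^bsub>C\<^esub> g t"
  shows "gao C"
proof unfold_locales
  have fg: "f x \<in> {z, m, t}" "g x \<in> {z, m, t}" if "x \<in> carrier C" for x
    using closed that by auto
  have f_mono: "f x \<sqsubseteq>\<^bsub>C\<^esub> f y" and g_mono: "g x \<sqsubseteq>\<^bsub>C\<^esub> g y"
    if "x \<in> carrier C" "y \<in> carrier C" "x \<sqsubseteq>\<^bsub>C\<^esub> y" for x y
    using that(1,2)[THEN carrier_cases] that(3) mono normal by (elim disjE; simp)+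
  show "\<box>\<^bsub>C\<^esub> \<top>\<^bsub>C\<^esub> = \<top>\<^bsub>C\<^esub>" "\<diamond>\<^bsub>C\<^esub> \<bottom>\<^bsub>C\<^esub> = \<bottom>\<^bsub>C\<^esub>"
    using normal by simp_all
  fix x y
  assume x: "x \<in> carrier C" and y: "y \<in> carrier C"
  show "\<box>\<^bsub>C\<^esub> x \<in> carrier C" "\<diamond>\<^bsub>C\<^esub> x \<in> carrier C"
    using fg[OF x] by simp_all
  have comparable: "x \<sqsubseteq>\<^bsub>C\<^esub> y \<or> y \<sqsubseteq>\<^bsub>C\<^esub> x"
    using x y total by blast
  show "\<box>\<^bsub>C\<^esub> (x \<sqinter>\<^bsub>C\<^esub> y) = \<box>\<^bsub>C\<^esub> x \<sqinter>\<^bsub>C\<^esub> \<box>\<^bsub>C\<^esub> y"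
    using comparable x y f_mono fg le_iff_join meet_comm by (metis chain3_simps(1,5))
  show "\<diamond>\<^bsub>C\<^esub> (x \<squnion>\<^bsub>C\<^esub> y) = \<diamond>\<^bsub>C\<^esub> x \<squnion>\<^bsub>C\<^esub> \<diamond>\<^bsub>C\<^esub> y"
    using comparable x y g_mono fg le_iff_meet join_comm by (metis chain3_simps(1,6))
qed

lemma not_boolean: "\<not> boolean_lattice C"
proof
  assume "boolean_lattice C"
  then interpret boolean_lattice C .
  show False
    \<comment> \<open>Disjointness from \<open>m\<close> forces the complement to be
      \<open>z\<close>, but \<open>m \<squnion> z\<close> is \<open>m\<close>, not
      \<open>t\<close>.\<close>
    using complemented[of m] by simp
qed

end

section \<open>The three witnesses\<close>

context
  fixes z m t :: 'a
  assumes distinct: "distinct [z, m, t]"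
begin

lemma chain3_id: "chain3 z m t id id \<in> FSDGAO - WGAO"
proof -
  interpret three_chain z m t id id
    using distinct by unfold_locales
  have "gao C"
    by (rule gao_chain3) simp_all
  then show ?thesis
    by (simp add: FSDGAO_def WGAO_def DGAO_def FSGAO_def neg_def)
qed

text \<open>In each D and FS inequality the left side is \<open>z\<close> or the right side is
  \<open>t\<close>.\<close>

lemma chain3_const:
  "chain3 z m t (\<lambda>_. t) (\<lambda>_. z) \<in> (WGAO \<inter> FSDGAO) - BAO"
proof -
  interpret three_chain z m t "\<lambda>_. t" "\<lambda>_. z"
    using distinct by unfold_locales
  have "gao C"
    by (rule gao_chain3) simp_all
  then show ?thesis
    using not_boolean by (simp add: FSDGAO_def WGAO_def DGAO_def FSGAO_def BAO_def neg_def)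
qed

text \<open>As \<open>h\<close> preserves meets and joins of the chain, both D inequalities hold
  with equality; its values \<open>z\<close> and \<open>t\<close> satisfy the excluded
  middle.\<close>

lemma chain3_indicator:
  assumes h [simp]: "h z = z" "h m = z" "h t = t"
  shows "chain3 z m t h h \<in> WGAO - FSGAO"
proof -
  interpret three_chain z m t h h
    using distinct by unfold_locales
  have "gao C"
    by (rule gao_chain3) simp_all
  then show ?thesis
    by (simp add: WGAO_def DGAO_def FSGAO_def neg_def)
qed

end

theorem proposition6p19:
  assumes "infinite (UNIV :: 'a set)"
  shows "(WGAO :: 'a gao set) \<subset> DGAO
    \<and> (WGAO :: 'a gao set) \<inter> FSDGAO \<noteq> {}
    \<and> (WGAO :: 'a gao set) \<inter> FSDGAO \<subset> FSDGAO
    \<and> (WGAO :: 'a gao set) - FSGAO \<noteq> {}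
    \<and> (BAO :: 'a gao set) \<subset> WGAO \<inter> FSGAO"
proof -
  \<comment> \<open>Infinity of the type supplies the three distinct points of the chain.\<close>
  obtain T :: "'a set" where "card T = 3"
    using infinite_arbitrarily_large[OF assms] by blast
  then obtain z m t :: 'a where distinct: "distinct [z, m, t]"
    by (auto simp: card_3_iff)
  define h where "h = (\<lambda>x. if x = t then t else z)"
  have "h z = z" "h m = z" "h t = t"
    using distinct by (simp_all add: h_def)
  note witnesses = chain3_id[OF distinct] chain3_const[OF distinct]
    chain3_indicator[OF distinct this]
  have "(WGAO :: 'a gao set) \<subseteq> DGAO" "(FSDGAO :: 'a gao set) = DGAO \<inter> FSGAO"
    by (auto simp: WGAO_def FSDGAO_def)
  \<comment> \<open>The identity witness makes (i) and (iii) strict, the constant pair gives (ii)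
    and strictness in (v), and the indicator gives (iv).\<close>
  then show ?thesis
    using witnesses BAO_subset by blast
qed

end
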